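(* Consider the mixed-integer problem $$\min_{x,\beta}\Big\{c^\top x:\ x\in X,\ \ (\beta_\omega=0\Rightarrow Ax\ge b^\omega)\ \forall \omega\in\Omega,\ \ \sum_{\omega\in\Omega}p_\omega\beta_\omega\le\epsilon,\ \ \beta\in\{0,1\}^N\Big\},\qquad (\ast)$$ with data as in the context. Let $(\bar x,\bar\beta)$ be a fractional (optimal basic) solution of the LP relaxation of $(\ast)$, let $J$ be the index set of the non-basic variables, $\{(r_x^j,r_\beta^j)\}_{j\in J}$ the corresponding extreme directions, and $\varphi^j(x,\beta)$, $j\in J$, the affine expressions of the non-basic variables. Fix a row $i\in[m]$ and set $h^\omega:=b_i^\omega$ for $\omega\in\Omega$, $\bar y:=A_i\bar x$, and $\bar z:=\mathbf 1-\bar\beta$. Let $f$, $\mathrm{EPM}_f$ and $\overline F_f$ be the associated set function, extended polymatroid and extended envelope (see context). Suppose $\bar y<\overline F_f(\bar z)$, where $\overline F_f(\bar z)=\bar\pi^\top\bar z$ for some $\bar\pi\in\mathrm{EPM}_f$. Then the inequality $$\sum_{j\in J}\max\left(0,\ \frac{A_i r_x^j+\bar\pi^\top r_\beta^j}{\bar\pi^\top(\mathbf 1-\bar\beta)-A_i\bar x}\right)\varphi^j(x,\beta)\ \ge\ 1$$ is valid for $(\ast)$, i.e. it is satisfied by every feasible solution $(x,\beta)$ of $(\ast)$. Moreover, it is violated by $(\bar x,\bar\beta)$.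
   Context: Data: $\Omega=\{1,\dots,N\}$; probabilities $p_\omega>0$ with $\sum_{\omega\in\Omega}p_\omega=1$; risk tolerance $\epsilon\in(0,1)$ with $p_\omega\le\epsilon$ for all $\omega$; $X\subseteq\mathbb R_+^n$ a deterministic set; $A\in\mathbb R^{m\times n}$ with rows $A_i$; $b^\omega\in\mathbb R_+^m$ (nonnegative) for each $\omega\in\Omega$. For each $\omega$ the polyhedron $\{x\in\mathbb R^n: Ax\ge b^\omega\}$ is nonempty. $[m]=\{1,\dots,m\}$, and $\mathbf 1$ is the all-ones vector. Set function: for $h^\omega\ge 0$, define $f:\{0,1\}^N\to\mathbb R$ by $f(z)=\max_{\omega\in\Omega:\,z_\omega=1}h^\omega$, with $f(\mathbf 0)=0$. Extended polymatroid: $\mathrm{EPM}_f=\{\pi\in\mathbb R^N:\ \pi^\top z\le f(z)\ \forall z\in\{0,1\}^N\}$, with set of extreme points $\mathrm{ext}(\mathrm{EPM}_f)$. Extended envelope: $\overline F_f(z)=\max_{\pi\in\mathrm{ext}(\mathrm{EPM}_f)}\pi^\top z$ for $z\in\mathbb R^N$. LP relaxation and tableau: the LP relaxation has as feasible region a polyhedron containing every feasible solution of $(\ast)$ and on which $0\le\beta_\omega\le1$. Fix the basis of the basic feasible solution $(\bar x,\bar\beta)$, with non-basic variables $s_j$, $j\in J$. In tableau form, every point of the LP relaxation (hence every feasible solution of $(\ast)$) can be written as $(x,\beta)=(\bar x,\bar\beta)+\sum_{j\in J}(r_x^j,r_\beta^j)s_j$ with $s_j\ge0$, where $(r_x^j,r_\beta^j)\in\mathbb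 R^n\times\mathbb R^N$ is the extreme direction associated with $s_j$. The affine function $\varphi^j(x,\beta)$ expresses the value of the non-basic variable $s_j$ in terms of $(x,\beta)$; so $s_j=\varphi^j(x,\beta)\ge0$ on the LP relaxation and $\varphi^j(\bar x,\bar\beta)=0$. *)

theory Defs
  imports "HOL-Analysis.Analysis"
begin

definition binary_vecs :: "(real^'w) set"
  where "binary_vecs = {z. \<forall>w. z $ w \<in> {0, 1}}"

definition ccp_feasible ::
    "(real^'n) set \<Rightarrow> real^'n^'m \<Rightarrow> ('w \<Rightarrow> real^'m) \<Rightarrow> ('w \<Rightarrow> real) \<Rightarrow> real \<Rightarrow> ((real^'n) \<times> (real^'w)) set"
  where "ccp_feasible X A b p \<epsilon> =
    {(x, \<beta>). x \<in> X \<and> (\<forall>w. \<beta> $ w = 0 \<longrightarrow> A *v x \<ge> b w) \<and>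
      (\<Sum>w\<in>UNIV. p w * \<beta> $ w) \<le> \<epsilon> \<and> \<beta> \<in> binary_vecs}"

text \<open>Only the values of the following function on \<open>binary_vecs\<close> matter.\<close>

definition max_fun :: "('w::finite \<Rightarrow> real) \<Rightarrow> real^'w \<Rightarrow> real"
  where "max_fun h z = (if z = 0 then 0 else Max (h ` {w. z $ w = 1}))"

definition EPM :: "(real^'w \<Rightarrow> real) \<Rightarrow> (real^'w) set"
  where "EPM f = {\<pi>. \<forall>z\<in>binary_vecs. \<pi> \<bullet> z \<le> f z}"

definition ext_EPM :: "(real^'w \<Rightarrow> real) \<Rightarrow> (real^'w) set"
  where "ext_EPM f = {\<pi>. \<pi> extreme_point_of EPM f}"

definition ext_envelope :: "(real^'w \<Rightarrow> real) \<Rightarrow> real^'w \<Rightarrow> real"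
  where "ext_envelope f z = Max ((\<lambda>\<pi>. \<pi> \<bullet> z) ` ext_EPM f)"

text \<open>The maximum in \<open>ext_envelope f z\<close> is over a finite set, nonempty whenever \<open>f 0 \<ge> 0\<close>.\<close>

lemma finite_binary_vecs: "finite (binary_vecs :: (real^'w) set)"
proof -
  have "binary_vecs \<subseteq> (\<lambda>g. \<chi> w. g w) ` (UNIV \<rightarrow>\<^sub>E ({0, 1} :: real set) :: ('w \<Rightarrow> real) set)"
  proof
    fix z :: "real^'w" assume "z \<in> binary_vecs"
    then have "($) z \<in> UNIV \<rightarrow>\<^sub>E {0, 1}" by (auto simp: binary_vecs_def)
    moreover have "z = (\<chi> w. z $ w)" by simp
    ultimately show "z \<in> (\<lambda>g. \<chi> w. g w) ` (UNIV \<rightarrow>\<^sub>E {0, 1})" by blast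
  qed
  then show ?thesis by (rule finite_subset) (intro finite_imageI finite_PiE; simp)
qed

lemma polyhedron_EPM: "polyhedron (EPM f)"
proof -
  have "EPM f = (\<Inter>z\<in>binary_vecs. {\<pi>. z \<bullet> \<pi> \<le> f z})"
    by (auto simp: EPM_def inner_commute)
  then show ?thesis
    by (auto intro!: polyhedron_Inter finite_imageI finite_binary_vecs simp: polyhedron_halfspace_le)
qed

lemma finite_ext_EPM: "finite (ext_EPM f)"
  unfolding ext_EPM_def by (rule finite_polyhedron_extreme_points[OF polyhedron_EPM])

lemma ext_EPM_nonempty:
  fixes f :: "real^'w \<Rightarrow> real"
  assumes f0: "f 0 \<ge> 0"
  shows "ext_EPM f \<noteq> {}"
proof -
  define m where "m = Min (insert 0 (f ` binary_vecs))"
  have m: "m \<le> 0" "\<And>z. z \<in> binary_vecs \<Longrightarrow> m \<le> f z"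
    unfolding m_def by (auto intro!: Min_le finite_imageI finite_binary_vecs)
  define q :: "real^'w" where "q = (\<chi> w. m)"
  have qE: "q \<in> EPM f"
  proof -
    have "q \<bullet> z \<le> f z" if z: "z \<in> binary_vecs" for z
    proof (cases "z = 0")
      case True then show ?thesis using f0 by simp
    next
      case False
      then obtain w where "z $ w \<noteq> 0" by (auto simp: vec_eq_iff)
      with z have w: "z $ w = 1" by (auto simp: binary_vecs_def)
      have nn: "\<And>v. z $ v \<ge> 0" using z by (auto simp: binary_vecs_def) (metis order_refl zero_le_one)
      have "1 \<le> (\<Sum>v\<in>UNIV. z $ v)"
        using member_le_sum[of w UNIV "($) z"] nn w by simp
      then have "m * (\<Sum>v\<in>UNIV. z $ v) \<le> m * 1" using m(1) by (rule mult_left_mono_neg)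
      then show ?thesis using m(2)[OF z]
        by (simp add: q_def inner_vec_def sum_distrib_left)
    qed
    then show ?thesis by (simp add: EPM_def)
  qed
  define S where "S = EPM f \<inter> {\<pi>. 1 \<bullet> \<pi> \<ge> 1 \<bullet> q}"
  have clE: "closed (EPM f)" by (rule polyhedron_imp_closed[OF polyhedron_EPM])
  have ub: "\<pi> $ w \<le> f (axis w 1)" if "\<pi> \<in> EPM f" for \<pi> w
  proof -
    have "axis w 1 \<in> (binary_vecs :: (real^'w) set)" by (auto simp: binary_vecs_def axis_def)
    then show ?thesis using that by (auto simp: EPM_def inner_axis)
  qed
  define M where "M = (\<Sum>w\<in>UNIV. \<bar>f (axis w 1)\<bar>) + \<bar>1 \<bullet> q\<bar>"
  have comp: "\<bar>\<pi> $ w\<bar> \<le> M" if "\<pi> \<in> S" for \<pi> w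
  proof -
    have E: "\<pi> \<in> EPM f" and s: "(\<Sum>v\<in>UNIV. \<pi> $ v) \<ge> 1 \<bullet> q"
      using that by (auto simp: S_def inner_vec_def)
    have "(\<Sum>v\<in>UNIV - {w}. \<pi> $ v) \<le> (\<Sum>v\<in>UNIV - {w}. \<bar>f (axis v 1)\<bar>)"
      by (rule sum_mono) (use ub[OF E] abs_ge_self order_trans in blast)
    moreover have "(\<Sum>v\<in>UNIV. \<pi> $ v) = \<pi> $ w + (\<Sum>v\<in>UNIV - {w}. \<pi> $ v)"
      by (simp add: sum.remove)
    moreover have "(\<Sum>v\<in>UNIV. \<bar>f (axis v 1)\<bar>) = \<bar>f (axis w 1)\<bar> + (\<Sum>v\<in>UNIV - {w}. \<bar>f (axis v 1)\<bar>)"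
      by (simp add: sum.remove)
    moreover have "0 \<le> (\<Sum>v\<in>UNIV - {w}. \<bar>f (axis v 1)\<bar>)" by (simp add: sum_nonneg)
    ultimately show ?thesis using s ub[OF E, of w] unfolding M_def by linarith
  qed
  have "bounded S"
    unfolding bounded_iff
  proof (intro exI ballI)
    fix \<pi> assume "\<pi> \<in> S"
    then have "(\<Sum>w\<in>UNIV. \<bar>\<pi> $ w\<bar>) \<le> (\<Sum>w\<in>(UNIV::'w set). M)" by (intro sum_mono comp)
    then show "norm \<pi> \<le> (\<Sum>w\<in>(UNIV::'w set). M)" using norm_le_l1_cart order_trans by blast
  qed
  moreover have "closed S"
    unfolding S_def by (intro closed_Int clE closed_halfspace_ge)
  ultimately have "compact S" by (simp add: compact_eq_bounded_closed)
  moreover have "q \<in> S" using qE by (simp add: S_def)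
  moreover have "continuous_on S (\<lambda>\<pi>. 1 \<bullet> \<pi>)" by (intro continuous_intros)
  ultimately obtain p where p: "p \<in> S" "\<And>\<pi>. \<pi> \<in> S \<Longrightarrow> 1 \<bullet> \<pi> \<le> 1 \<bullet> p"
    using continuous_attains_sup[of S "\<lambda>\<pi>. 1 \<bullet> \<pi>"] by blast
  have pm: "1 \<bullet> \<pi> \<le> 1 \<bullet> p" if "\<pi> \<in> EPM f" for \<pi>
    using p that unfolding S_def by fastforce
  define F where "F = EPM f \<inter> {\<pi>. 1 \<bullet> \<pi> = 1 \<bullet> p}"
  have face: "F face_of EPM f"
    unfolding F_def by (rule face_of_Int_supporting_hyperplane_le)
      (use pm polyhedron_EPM polyhedron_imp_convex in auto)
  have "F = S \<inter> {\<pi>. 1 \<bullet> \<pi> = 1 \<bullet> p}" using p(1) by (auto simp: F_def S_def)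
  then have "compact F" using \<open>compact S\<close>
    by (simp add: compact_Int_closed closed_hyperplane)
  moreover have "p \<in> F" using p(1) by (simp add: F_def S_def)
  moreover have "convex F" by (rule face_of_imp_convex[OF face])
  ultimately obtain e where "e extreme_point_of F"
    using extreme_point_exists_convex[of F] by blast
  then have "e extreme_point_of EPM f" using extreme_point_of_face[OF face] by blast
  then show ?thesis by (auto simp: ext_EPM_def)
qed

text \<open>
  A linear program in \<open>v = (x, \<beta>)\<close> is given by a finite system: inequality rows
  \<open>G k \<bullet> v \<ge> d k\<close> (\<open>k \<in> I\<close>, sign and bound constraints included) and equality rows
  \<open>G k \<bullet> v = d k\<close> (\<open>k \<in> E\<close>).  Each inequality row carries the nonnegative variable
  \<open>lp_var G d k v = G k \<bullet> v - d k\<close>: the slack of a general constraint, and the structural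
  variable itself (or its complement to the bound) for a sign or bound constraint.
  Equality rows carry no variable.
\<close>

definition lp_region :: "('k \<Rightarrow> 'a::euclidean_space) \<Rightarrow> ('k \<Rightarrow> real) \<Rightarrow> 'k set \<Rightarrow> 'k set \<Rightarrow> 'a set"
  where "lp_region G d I E = {v. (\<forall>k\<in>I. G k \<bullet> v \<ge> d k) \<and> (\<forall>k\<in>E. G k \<bullet> v = d k)}"

definition lp_var :: "('k \<Rightarrow> 'a::euclidean_space) \<Rightarrow> ('k \<Rightarrow> real) \<Rightarrow> 'k \<Rightarrow> 'a \<Rightarrow> real"
  where "lp_var G d k v = G k \<bullet> v - d k"

text \<open>
  \<open>J\<close> is the nonbasic set of a basis: its rows, together with a maximal independent subfamily
  \<open>E'\<close> of the equality rows, form a basis of the space.  Hence on the affine space cut out by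
  the equality rows the nonbasic variables are affine coordinates.
\<close>

definition lp_nonbasic :: "('k \<Rightarrow> 'a::euclidean_space) \<Rightarrow> 'k set \<Rightarrow> 'k set \<Rightarrow> 'k set \<Rightarrow> bool"
  where "lp_nonbasic G I E J \<longleftrightarrow> J \<subseteq> I \<and>
    (\<exists>E'\<subseteq>E. span (G ` E') = span (G ` E) \<and> inj_on G (J \<union> E') \<and>
      independent (G ` (J \<union> E')) \<and> span (G ` (J \<union> E')) = UNIV)"

definition lp_basic_feasible ::
    "('k \<Rightarrow> 'a::euclidean_space) \<Rightarrow> ('k \<Rightarrow> real) \<Rightarrow> 'k set \<Rightarrow> 'k set \<Rightarrow> 'k set \<Rightarrow> 'a \<Rightarrow> bool"
  where "lp_basic_feasible G d I E J v \<longleftrightarrow>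
    lp_nonbasic G I E J \<and> v \<in> lp_region G d I E \<and> (\<forall>j\<in>J. lp_var G d j v = 0)"

text \<open>
  The direction of \<open>j \<in> J\<close>: the nonbasic variable \<open>j\<close> increases at unit rate, the other nonbasic
  variables stay fixed and the equality rows are preserved.
\<close>

definition lp_direction :: "('k \<Rightarrow> 'a::euclidean_space) \<Rightarrow> 'k set \<Rightarrow> 'k set \<Rightarrow> 'k \<Rightarrow> 'a \<Rightarrow> bool"
  where "lp_direction G E J j r \<longleftrightarrow>
    (\<forall>k\<in>J. G k \<bullet> r = (if k = j then 1 else 0)) \<and> (\<forall>k\<in>E. G k \<bullet> r = 0)"

text \<open>The simplex tableau in these terms.\<close>

lemma lp_tableau:
  assumes bfs: "lp_basic_feasible G d I E J v0" and fin: "finite J"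
    and dir: "\<And>j. j \<in> J \<Longrightarrow> lp_direction G E J j (r j)"
    and v: "\<And>k. k \<in> E \<Longrightarrow> G k \<bullet> v = d k"
  shows "v = v0 + (\<Sum>j\<in>J. lp_var G d j v *\<^sub>R r j)"
proof -
  define u where "u = v - v0 - (\<Sum>j\<in>J. lp_var G d j v *\<^sub>R r j)"
  obtain E' where E': "E' \<subseteq> E" "span (G ` (J \<union> E')) = UNIV"
    using bfs by (auto simp: lp_basic_feasible_def lp_nonbasic_def)
  have "G k \<bullet> u = 0" if "k \<in> J \<union> E'" for k
  proof (cases "k \<in> J")
    case True
    have "(\<Sum>j\<in>J. lp_var G d j v * (G k \<bullet> r j)) = (\<Sum>j\<in>J. if j = k then lp_var G d j v else 0)"
      using dir True by (intro sum.cong) (auto simp: lp_direction_def)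
    also have "\<dots> = lp_var G d k v" using fin True by simp
    finally show ?thesis using bfs True
      by (simp add: u_def inner_diff_right inner_sum_right lp_basic_feasible_def lp_var_def)
  next
    case False
    then have k: "k \<in> E" using that E' by auto
    have "(\<Sum>j\<in>J. lp_var G d j v * (G k \<bullet> r j)) = 0"
      using dir k by (intro sum.neutral) (auto simp: lp_direction_def)
    then show ?thesis using bfs v[OF k] k
      by (simp add: u_def inner_diff_right inner_sum_right lp_basic_feasible_def lp_region_def)
  qed
  then have "orthogonal u y" if "y \<in> G ` (J \<union> E')" for y
    using that by (auto simp: orthogonal_def inner_commute)
  then have "orthogonal u u"
    using orthogonal_to_span[of u "G ` (J \<union> E')" u] E'(2) by auto
  then have "u = 0" by (simp add: orthogonal_def)
  then show ?thesis by (simp add: u_def algebra_simps)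
qed

lemma lp_direction_exists:
  assumes nb: "lp_nonbasic G I E J" and disj: "I \<inter> E = {}" and j: "j \<in> J"
  shows "\<exists>r. lp_direction G E J j r"
proof -
  obtain E' where JI: "J \<subseteq> I" and E': "E' \<subseteq> E" "span (G ` E') = span (G ` E)"
    "inj_on G (J \<union> E')" "independent (G ` (J \<union> E'))"
    using nb by (auto simp: lp_nonbasic_def)
  obtain g :: "'b \<Rightarrow> real" where g: "linear g"
    "\<forall>y\<in>G ` (J \<union> E'). g y = (if y = G j then 1 else 0)"
    using linear_independent_extend[OF E'(4), of "\<lambda>y. if y = G j then 1 else 0"] by blast
  have inn: "y \<bullet> adjoint g 1 = g y" for y
    using adjoint_works[OF g(1), of y 1] by simp
  have "g (G k) = (if k = j then 1 else 0)" if "k \<in> J" for k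
    using g(2) that j E'(3) by (auto simp: inj_on_def)
  moreover have "g (G k) = 0" if k: "k \<in> E" for k
  proof -
    have "g y = 0" if y: "y \<in> G ` E'" for y
    proof -
      obtain l where l: "l \<in> E'" "y = G l" by (rule imageE[OF y])
      have lE: "l \<in> E" by (rule subsetD[OF E'(1) l(1)])
      have jI: "j \<in> I" by (rule subsetD[OF JI j])
      have "l \<noteq> j" using lE jI disj by (metis IntI empty_iff)
      then have "G l \<noteq> G j" using inj_on_eq_iff[OF E'(3), of l j] l(1) j by simp
      moreover have "G l \<in> G ` (J \<union> E')" using l(1) by (intro imageI UnI2)
      ultimately show ?thesis using bspec[OF g(2), of "G l"] l(2) by simp
    qed
    moreover have "G k \<in> span (G ` E')" unfolding E'(2) by (rule span_base[OF imageI[OF k]])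
    ultimately show ?thesis by (rule linear_eq_0_on_span[OF g(1)])
  qed
  ultimately have "lp_direction G E J j (adjoint g 1)" by (simp add: lp_direction_def inn)
  then show ?thesis by (rule exI)
qed

end

theory Submission
  imports Defs
begin

text \<open>
  The cut is an intersection cut taken from a half-space.  Write \<open>v = (x, \<beta>)\<close>.  For binary \<open>z\<close>,
  membership of \<open>\<pi>0\<close> in the extended polymatroid says \<open>\<pi>0 \<bullet> z \<le> f z\<close>, and at a feasible point
  with \<open>z = 1 - \<beta>\<close> the value \<open>f z\<close> is the largest right-hand side among the scenarios that the
  point has to satisfy in row \<open>i\<close>.  So every feasible point lies in the half-space
  \<open>row i A \<bullet> x + \<pi>0 \<bullet> \<beta> \<ge> \<pi>0 \<bullet> 1\<close>
  (\<open>feasible_satisfies_EPM_inequality\<close>), while the separation hypothesis puts the basic solution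
  \<open>(x0, \<beta>0)\<close> strictly outside it, with a shortfall of \<open>\<pi>0 \<bullet> (1 - \<beta>0) - row i A \<bullet> x0\<close>.

  The simplex tableau writes a feasible point as \<open>(x0, \<beta>0)\<close> plus a nonnegative combination of the
  directions, with the nonbasic variables as weights.  To reach the half-space, these steps must
  together make up the shortfall; dividing by it, and dropping the directions that lead away from
  the half-space, gives the inequality (\<open>half_space_intersection_cut\<close>).  At \<open>(x0, \<beta>0)\<close> all
  nonbasic variables vanish, so its left-hand side is \<open>0\<close>.
\<close>

text \<open>
  A probability budget below \<open>1\<close> forbids \<open>\<beta> = 1\<close>, that is, giving up every scenario.  This matters
  because \<open>f\<close> vanishes at \<open>z = 0\<close> by convention, and row \<open>i\<close> of the system
  would not be bounded below by any scenario there.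
\<close>

lemma feasible_keeps_some_scenario:
  assumes feas: "(x, \<beta>) \<in> ccp_feasible X A b p \<epsilon>"
    and p_sum: "(\<Sum>w\<in>UNIV. p w) = 1" and \<epsilon>: "\<epsilon> < 1"
  shows "\<beta> \<noteq> 1"
  using assms by (auto simp: ccp_feasible_def)

text \<open>
  The link between the probabilistic part and the half-space: some scenario \<open>w\<close> with \<open>\<beta> $ w = 0\<close>
  remains, so \<open>max_fun\<close> at \<open>1 - \<beta>\<close> is a genuine maximum of bounds \<open>b w $ i\<close> that \<open>x\<close> satisfies.
\<close>

lemma feasible_satisfies_EPM_inequality:
  fixes A :: "real^'n^'m" and b :: "'w::finite \<Rightarrow> real^'m"
  assumes feas: "(x, \<beta>) \<in> ccp_feasible X A b p \<epsilon>"
    and p_sum: "(\<Sum>w\<in>UNIV. p w) = 1" and \<epsilon>: "\<epsilon> < 1"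
    and \<pi>: "\<pi> \<in> EPM (max_fun (\<lambda>w. b w $ i))"
  shows "\<pi> \<bullet> (1 - \<beta>) \<le> row i A \<bullet> x"
proof -
  have bin: "\<beta> \<in> binary_vecs" and scen: "\<And>w. \<beta> $ w = 0 \<Longrightarrow> b w \<le> A *v x"
    using feas by (auto simp: ccp_feasible_def)
  have bin': "1 - \<beta> \<in> binary_vecs"
    using bin by (fastforce simp: binary_vecs_def)
  have "\<beta> \<noteq> 1"
    using feas p_sum \<epsilon> by (rule feasible_keeps_some_scenario)
  then have nonzero: "1 - \<beta> \<noteq> 0" by auto
  then obtain v where "(1 - \<beta>) $ v \<noteq> 0"
    by (auto simp: vec_eq_iff)
  then have v: "(1 - \<beta>) $ v = 1"
    using bin' by (auto simp: binary_vecs_def)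
  have row_bound: "b w $ i \<le> row i A \<bullet> x" if "(1 - \<beta>) $ w = 1" for w
  proof -
    have "b w $ i \<le> (A *v x) $ i"
      using scen[of w] that by (simp add: less_eq_vec_def)
    then show ?thesis by (simp add: matrix_vector_mul_component row_def)
  qed
  have "\<pi> \<bullet> (1 - \<beta>) \<le> max_fun (\<lambda>w. b w $ i) (1 - \<beta>)"
    using \<pi> bin' by (simp add: EPM_def)
  also have "\<dots> = Max ((\<lambda>w. b w $ i) ` {w. (1 - \<beta>) $ w = 1})"
    using nonzero by (simp add: max_fun_def)
  also have "\<dots> \<le> row i A \<bullet> x"
    using v row_bound by (subst Max_le_iff) auto
  finally show ?thesis .
qed

text \<open>
  The functional \<open>a\<close> must grow by at least \<open>\<tau> - a \<bullet> v0 > 0\<close> on the way from \<open>v0\<close> to \<open>v\<close>, and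
  direction \<open>r j\<close> contributes the growth \<open>s j * (a \<bullet> r j)\<close>.
  Since the weights are nonnegative, replacing negative contributions by \<open>0\<close> only enlarges the sum.
\<close>

lemma half_space_intersection_cut:
  fixes a v0 v :: "'a::real_inner" and r :: "'k \<Rightarrow> 'a"
  assumes v: "v = v0 + (\<Sum>j\<in>J. s j *\<^sub>R r j)"
    and s: "\<And>j. j \<in> J \<Longrightarrow> 0 \<le> s j"
    and outside: "a \<bullet> v0 < \<tau>" and inside: "\<tau> \<le> a \<bullet> v"
  shows "1 \<le> (\<Sum>j\<in>J. max 0 (a \<bullet> r j / (\<tau> - a \<bullet> v0)) * s j)"
proof -
  have "\<tau> - a \<bullet> v0 \<le> (\<Sum>j\<in>J. s j * (a \<bullet> r j))"
    using inside by (simp add: v inner_add_right inner_sum_right)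
  then have "1 \<le> (\<Sum>j\<in>J. s j * (a \<bullet> r j)) / (\<tau> - a \<bullet> v0)"
    using outside by (simp add: le_divide_eq)
  also have "\<dots> = (\<Sum>j\<in>J. (a \<bullet> r j / (\<tau> - a \<bullet> v0)) * s j)"
    by (simp add: sum_divide_distrib mult.commute)
  also have "\<dots> \<le> (\<Sum>j\<in>J. max 0 (a \<bullet> r j / (\<tau> - a \<bullet> v0)) * s j)"
    using s by (intro sum_mono mult_right_mono) auto
  finally show ?thesis .
qed

theorem theorem2:
  fixes X :: "(real^'n) set"
    and A :: "real^'n^'m"
    and b :: "'w::finite \<Rightarrow> real^'m"
    and p :: "'w \<Rightarrow> real"
    and \<epsilon> :: real
    and c :: "real^'n"
    and i :: 'm
    and G :: "'k \<Rightarrow> (real^'n) \<times> (real^'w)"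
    and d :: "'k \<Rightarrow> real"
    and I E J :: "'k set"
    and x0 :: "real^'n"
    and \<beta>0 \<pi>0 :: "real^'w"
    and rx :: "'k \<Rightarrow> real^'n"
    and r\<beta> :: "'k \<Rightarrow> real^'w"
  assumes p_pos: "\<And>w. p w > 0"
    and p_sum: "(\<Sum>w\<in>UNIV. p w) = 1"
    and \<epsilon>: "0 < \<epsilon>" "\<epsilon> < 1"
    and p_le: "\<And>w. p w \<le> \<epsilon>"
    and X_nonneg: "\<And>x. x \<in> X \<Longrightarrow> x \<ge> 0"
    and b_nonneg: "\<And>w. b w \<ge> 0"
    and scen_nonempty: "\<And>w. {x. A *v x \<ge> b w} \<noteq> {}"
    and lp_finite: "finite I" "finite E" "I \<inter> E = {}"
    and lp_relax: "ccp_feasible X A b p \<epsilon> \<subseteq> lp_region G d I E"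
    and lp_\<beta>: "\<And>x \<beta> w. (x, \<beta>) \<in> lp_region G d I E \<Longrightarrow> 0 \<le> \<beta> $ w \<and> \<beta> $ w \<le> 1"
    and bfs: "lp_basic_feasible G d I E J (x0, \<beta>0)"
    and optimal: "\<And>x \<beta>. (x, \<beta>) \<in> lp_region G d I E \<Longrightarrow> c \<bullet> x0 \<le> c \<bullet> x"
    and fractional: "\<beta>0 \<notin> binary_vecs"
    and directions: "\<And>j. j \<in> J \<Longrightarrow> lp_direction G E J j (rx j, r\<beta> j)"
    and separated: "row i A \<bullet> x0 < ext_envelope (max_fun (\<lambda>w. b w $ i)) (1 - \<beta>0)"
    and \<pi>0_EPM: "\<pi>0 \<in> EPM (max_fun (\<lambda>w. b w $ i))"
    and \<pi>0_max: "ext_envelope (max_fun (\<lambda>w. b w $ i)) (1 - \<beta>0) = \<pi>0 \<bullet> (1 - \<beta>0)"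
  shows "let cut = (\<lambda>x \<beta>. (\<Sum>j\<in>J.
             max 0 ((row i A \<bullet> rx j + \<pi>0 \<bullet> r\<beta> j) / (\<pi>0 \<bullet> (1 - \<beta>0) - row i A \<bullet> x0))
               * lp_var G d j (x, \<beta>)) \<ge> 1)
         in (\<forall>(x, \<beta>) \<in> ccp_feasible X A b p \<epsilon>. cut x \<beta>) \<and> \<not> cut x0 \<beta>0"
proof -
  \<comment> \<open>The half-space of the cut is \<open>a \<bullet> (x, \<beta>) \<ge> \<pi>0 \<bullet> 1\<close>.\<close>
  define a where "a = (row i A, \<pi>0)"
  have gap: "\<pi>0 \<bullet> (1 - \<beta>0) - row i A \<bullet> x0 = \<pi>0 \<bullet> 1 - a \<bullet> (x0, \<beta>0)"
    by (simp add: a_def inner_diff_right)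
  have growth: "row i A \<bullet> rx j + \<pi>0 \<bullet> r\<beta> j = a \<bullet> (rx j, r\<beta> j)" for j
    by (simp add: a_def)
  have outside: "a \<bullet> (x0, \<beta>0) < \<pi>0 \<bullet> 1"
    using separated \<pi>0_max gap by linarith
  have JI: "J \<subseteq> I" and at_vertex: "\<And>j. j \<in> J \<Longrightarrow> lp_var G d j (x0, \<beta>0) = 0"
    using bfs by (auto simp: lp_basic_feasible_def lp_nonbasic_def)
  have valid: "1 \<le> (\<Sum>j\<in>J. max 0 ((row i A \<bullet> rx j + \<pi>0 \<bullet> r\<beta> j) /
      (\<pi>0 \<bullet> (1 - \<beta>0) - row i A \<bullet> x0)) * lp_var G d j (x, \<beta>))"
    if feas: "(x, \<beta>) \<in> ccp_feasible X A b p \<epsilon>" for x \<beta>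
    unfolding gap growth
  proof (rule half_space_intersection_cut)
    have region: "(x, \<beta>) \<in> lp_region G d I E"
      using lp_relax feas by blast
    show "(x, \<beta>) = (x0, \<beta>0) + (\<Sum>j\<in>J. lp_var G d j (x, \<beta>) *\<^sub>R (rx j, r\<beta> j))"
      using bfs finite_subset[OF JI lp_finite(1)] directions
      by (rule lp_tableau) (use region in \<open>auto simp: lp_region_def\<close>)
    show "0 \<le> lp_var G d j (x, \<beta>)" if "j \<in> J" for j
      using region that JI by (auto simp: lp_region_def lp_var_def)
    show "a \<bullet> (x0, \<beta>0) < \<pi>0 \<bullet> 1" by (rule outside)
    show "\<pi>0 \<bullet> 1 \<le> a \<bullet> (x, \<beta>)"
      using feasible_satisfies_EPM_inequality[OF feas p_sum \<epsilon>(2) \<pi>0_EPM]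
      by (simp add: a_def inner_diff_right)
  qed
  then show ?thesis
    using at_vertex by (auto simp: Let_def)
qed

end
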